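(* Let $n \ge 4$ be an integer with $n \ne 6$, and let $\rho$ be an integer with $1 \le \rho \le n-1$. Then there exists a $(3n-1+\rho,4)$-packing with exactly $(n-1)\rho + D(\rho,4)$ blocks in which the largest partial parallel class has size $\rho$.
   Context: For integers $v \ge k \ge 2$, a $(v,k)$-packing is a pair $(X,\mathcal{B})$ where $X$ is a set of $v$ points and $\mathcal{B}$ is a set of $k$-subsets of $X$ (blocks) such that every pair of distinct points lies in at most one block. For integers $m \ge 0$, $D(m,k)$ denotes the maximum number of $k$-subsets of an $m$-set such that every pair of points lies in at most one of them (so $D(m,k)=0$ if $m<k$). A partial parallel class (PPC) is a set of pairwise disjoint blocks; its size is the number of blocks. "The largest PPC has size $\rho$" means the packing has a PPC of size $\rho$ but none of size $\rho+1$. *)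

theory Defs
  imports Main
begin

definition is_packing :: "nat \<Rightarrow> 'a set \<Rightarrow> 'a set set \<Rightarrow> bool" where
  "is_packing k X B \<longleftrightarrow> finite X \<and>
     (\<forall>b\<in>B. b \<subseteq> X \<and> card b = k) \<and>
     (\<forall>b1\<in>B. \<forall>b2\<in>B. b1 \<noteq> b2 \<longrightarrow> card (b1 \<inter> b2) \<le> 1)"

definition D :: "nat \<Rightarrow> nat \<Rightarrow> nat" where
  "D m k = Max {card B | B. is_packing k {0..<m} (B :: nat set set)}"

definition is_ppc :: "'a set set \<Rightarrow> 'a set set \<Rightarrow> bool" where
  "is_ppc B P \<longleftrightarrow> P \<subseteq> B \<and> (\<forall>b1\<in>P. \<forall>b2\<in>P. b1 \<noteq> b2 \<longrightarrow> b1 \<inter> b2 = {})"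

definition largest_ppc_size :: "'a set set \<Rightarrow> nat \<Rightarrow> bool" where
  "largest_ppc_size B r \<longleftrightarrow> (\<exists>P. is_ppc B P \<and> card P = r) \<and>
     \<not> (\<exists>P. is_ppc B P \<and> card P = r + 1)"

end

theory Submission
  imports Defs
begin

text \<open>
  Put \<open>m = n - 1\<close>. Suppose that \<open>3m + 2\<close> points carry \<open>m\<close> classes of \<open>m\<close> pairwise disjoint triples such
  that every pair of points lies in at most one triple, together with a rainbow matching: one triple
  from each class, all of them disjoint. Attach a new point to all triples of each of \<open>\<rho>\<close> classes, and
  add a maximum packing on the \<open>\<rho>\<close> new points. Every block then meets the set of new points, so no
  partial parallel class has more than \<open>\<rho>\<close> blocks, and the extended rainbow matching attains \<open>\<rho>\<close>.

  To obtain the classes for \<open>q\<close> prime to 6, take three copies of the integers mod \<open>q\<close>, the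
  triples \<open>(x, x + t, t - x)\<close> in class \<open>t\<close>, and the rainbow matching \<open>t = 2x\<close>. Deleting no point
  or one point gives \<open>m\<close> congruent to 0, 1, 4, 5 mod 6, and the same construction over the fields of
  order 4 and 9 gives \<open>m = 3, 8, 9\<close>. The remaining \<open>m\<close> are reached from \<open>q = m - 1\<close> by adding
  points and from \<open>q = m + 2\<close> by deleting points. In both cases the classes are repaired with
  triples inside a single copy, whose pairs the cyclic construction leaves unused.
\<close>

section \<open>Classes of disjoint triples with a rainbow matching\<close>

text \<open>Only inequalities are demanded of the cardinalities, so a construction may fall short of
  the points or exceed the classes and triples required; any surplus is trimmed when the packing is
  built. Class labels have a type of their own because they are residues or field elements, while
  points also carry the number of their copy.\<close>

definition rainbow_classes ::
  "nat \<Rightarrow> 'p set \<Rightarrow> 'c set \<Rightarrow> ('c \<Rightarrow> 'p set set) \<Rightarrow> ('c \<Rightarrow> 'p set) \<Rightarrow> bool" where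
  "rainbow_classes m V C P R \<longleftrightarrow>
     finite V \<and> card V \<le> 3 * m + 2 \<and> finite C \<and> m \<le> card C \<and>
     (\<forall>c\<in>C. finite (P c) \<and> m \<le> card (P c)) \<and>
     (\<forall>c\<in>C. \<forall>b\<in>P c. b \<subseteq> V \<and> card b = 3) \<and>
     (\<forall>c\<in>C. \<forall>b\<in>P c. \<forall>b'\<in>P c. b \<noteq> b' \<longrightarrow> b \<inter> b' = {}) \<and>
     (\<forall>c\<in>C. \<forall>c'\<in>C. \<forall>b\<in>P c. \<forall>b'\<in>P c'. \<forall>x\<in>b \<inter> b'. \<forall>y\<in>b \<inter> b'. c \<noteq> c' \<longrightarrow> x = y) \<and>
     (\<forall>c\<in>C. R c \<in> P c) \<and>
     (\<forall>c\<in>C. \<forall>c'\<in>C. c \<noteq> c' \<longrightarrow> R c \<inter> R c' = {})"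

lemma rainbow_classesI:
  assumes "finite V" "card V \<le> 3 * m + 2" "finite C" "m \<le> card C"
    and "\<And>c. c \<in> C \<Longrightarrow> finite (P c)" "\<And>c. c \<in> C \<Longrightarrow> m \<le> card (P c)"
    and "\<And>c b. c \<in> C \<Longrightarrow> b \<in> P c \<Longrightarrow> b \<subseteq> V"
    and "\<And>c b. c \<in> C \<Longrightarrow> b \<in> P c \<Longrightarrow> card b = 3"
    and "\<And>c b b' x. c \<in> C \<Longrightarrow> b \<in> P c \<Longrightarrow> b' \<in> P c \<Longrightarrow> x \<in> b \<Longrightarrow> x \<in> b' \<Longrightarrow> b = b'"
    and "\<And>c c' b b' x y. c \<in> C \<Longrightarrow> c' \<in> C \<Longrightarrow> b \<in> P c \<Longrightarrow> b' \<in> P c' \<Longrightarrow> c \<noteq> c'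
           \<Longrightarrow> x \<in> b \<Longrightarrow> x \<in> b' \<Longrightarrow> y \<in> b \<Longrightarrow> y \<in> b' \<Longrightarrow> x = y"
    and "\<And>c. c \<in> C \<Longrightarrow> R c \<in> P c"
    and "\<And>c c' x. c \<in> C \<Longrightarrow> c' \<in> C \<Longrightarrow> x \<in> R c \<Longrightarrow> x \<in> R c' \<Longrightarrow> c = c'"
  shows "rainbow_classes m V C P R"
  unfolding rainbow_classes_def
proof (intro conjI ballI impI)
  fix c b b' assume "c \<in> C" "b \<in> P c" "b' \<in> P c" "b \<noteq> b'"
  then show "b \<inter> b' = {}" using assms(9) by (metis disjoint_iff)
next
  fix c c' assume "c \<in> C" "c' \<in> C" "c \<noteq> c'"
  then show "R c \<inter> R c' = {}" using assms(12) by (metis disjoint_iff)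
next
  fix c c' b b' x y
  assume "c \<in> C" "c' \<in> C" "b \<in> P c" "b' \<in> P c'" "x \<in> b \<inter> b'" "y \<in> b \<inter> b'" "c \<noteq> c'"
  then show "x = y" using assms(10)[of c c' b b' x y] by simp
qed (use assms(1-8,11) in auto)

section \<open>From rainbow classes to packings\<close>

lemma D_attained: "\<exists>B :: nat set set. is_packing k {0..<m} B \<and> card B = D m k"
proof -
  let ?S = "{card B | B. is_packing k {0..<m} (B :: nat set set)}"
  have "?S \<subseteq> card ` Pow (Pow {0..<m})" by (auto simp: is_packing_def)
  then have "finite ?S" by (rule finite_subset) auto
  moreover have "is_packing k {0..<m} {}" by (simp add: is_packing_def)
  then have "?S \<noteq> {}" by blast
  ultimately have "Max ?S \<in> ?S" by (rule Max_in)
  then show ?thesis unfolding D_def by auto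
qed

text \<open>Choosing a point of \<open>S\<close> from each member is injective by disjointness. With
  \<open>S\<close> the set of new points this bounds every partial parallel class.\<close>

lemma card_disjoint_family_le:
  assumes "finite S" and "\<And>b. b \<in> P \<Longrightarrow> b \<inter> S \<noteq> {}"
    and "\<And>b b'. b \<in> P \<Longrightarrow> b' \<in> P \<Longrightarrow> b \<noteq> b' \<Longrightarrow> b \<inter> b' = {}"
  shows "card P \<le> card S"
proof -
  have "\<forall>b\<in>P. \<exists>x. x \<in> b \<inter> S" using assms(2) by blast
  then obtain f where f: "\<And>b. b \<in> P \<Longrightarrow> f b \<in> b \<inter> S"
    using bchoice[of P "\<lambda>b x. x \<in> b \<inter> S"] by blast
  have "inj_on f P"
    using f assms(3) by (intro inj_onI) (metis IntD1 disjoint_iff)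
  moreover have "f ` P \<subseteq> S" using f by blast
  ultimately show ?thesis using card_inj_on_le assms(1) by blast
qed

text \<open>Everything is transported to natural numbers: old points go below \<open>N\<close>, the
  class numbered \<open>i\<close> receives the new point \<open>N + i\<close>, and the maximum
  packing on the new points is a shifted copy. If \<open>V\<close> has fewer than \<open>N\<close>
  points, the remaining numbers are isolated points.\<close>

lemma packing_of_rainbow_classes:
  fixes m \<rho> :: nat
  assumes "\<exists>(V :: 'p set) (C :: 'c set) P R. rainbow_classes m V C P R" and "\<rho> \<le> m" "1 \<le> m"
  shows "\<exists>(X :: nat set) B. card X = 3 * m + 2 + \<rho> \<and> is_packing 4 X B \<and>
           card B = m * \<rho> + D \<rho> 4 \<and> largest_ppc_size B \<rho>"
proof -
  obtain V :: "'p set" and C :: "'c set" and P R where rc: "rainbow_classes m V C P R"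
    using assms(1) by blast
  define N where "N = 3 * m + 2"
  have fV: "finite V" and fP: "\<And>c. c \<in> C \<Longrightarrow> finite (P c)" and mP: "\<And>c. c \<in> C \<Longrightarrow> m \<le> card (P c)"
    and PV: "\<And>c b. c \<in> C \<Longrightarrow> b \<in> P c \<Longrightarrow> b \<subseteq> V"
    and P3: "\<And>c b. c \<in> C \<Longrightarrow> b \<in> P c \<Longrightarrow> card b = 3"
    and Pd: "\<And>c b b'. c \<in> C \<Longrightarrow> b \<in> P c \<Longrightarrow> b' \<in> P c \<Longrightarrow> b \<noteq> b' \<Longrightarrow> b \<inter> b' = {}"
    and PP: "\<And>c c' b b' x y. c \<in> C \<Longrightarrow> c' \<in> C \<Longrightarrow> b \<in> P c \<Longrightarrow> b' \<in> P c' \<Longrightarrow> c \<noteq> c' \<Longrightarrow>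
               x \<in> b \<inter> b' \<Longrightarrow> y \<in> b \<inter> b' \<Longrightarrow> x = y"
    and RP: "\<And>c. c \<in> C \<Longrightarrow> R c \<in> P c"
    and Rd: "\<And>c c'. c \<in> C \<Longrightarrow> c' \<in> C \<Longrightarrow> c \<noteq> c' \<Longrightarrow> R c \<inter> R c' = {}"
    and cV: "card V \<le> N" and "finite C" "m \<le> card C"
    using rc unfolding rainbow_classes_def N_def by (simp_all, (metis+)?)
  obtain f where f: "f ` V \<subseteq> {0..<N}" "inj_on f V"
    using card_le_inj[of V "{0..<N}"] fV cV by auto
  obtain C0 where C0: "C0 \<subseteq> C" "card C0 = \<rho>" "finite C0"
    by (metis \<open>\<rho> \<le> m\<close> \<open>m \<le> card C\<close> obtain_subset_with_card_n le_trans)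
  obtain h where h: "bij_betw h {0..<\<rho>} C0"
    using ex_bij_betw_nat_finite[OF C0(3)] C0(2) by auto
  have hC: "h i \<in> C" if "i < \<rho>" for i
    using h C0(1) that by (auto simp: bij_betw_def)
  have hinj: "h i \<noteq> h j" if "i < \<rho>" "j < \<rho>" "i \<noteq> j" for i j
    using h that by (auto simp: bij_betw_def inj_on_def)
  \<comment> \<open>Trimming a class to exactly \<open>m\<close> triples must keep its matching
    triple, so only \<open>m - 1\<close> others are chosen.\<close>
  have "\<exists>Q. R c \<in> Q \<and> Q \<subseteq> P c \<and> card Q = m" if c: "c \<in> C" for c
  proof -
    have "m - 1 \<le> card (P c - {R c})" using mP[OF c] RP[OF c] fP[OF c] by (simp add: card_Diff_singleton)
    then obtain Q where Q: "Q \<subseteq> P c - {R c}" "card Q = m - 1" "finite Q"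
      by (rule obtain_subset_with_card_n)
    then show ?thesis using RP[OF c] \<open>1 \<le> m\<close>
      by (intro exI[of _ "insert (R c) Q"]) (auto simp: card_insert_if)
  qed
  then obtain Q where Q: "\<And>c. c \<in> C \<Longrightarrow> R c \<in> Q c" "\<And>c. c \<in> C \<Longrightarrow> Q c \<subseteq> P c"
      "\<And>c. c \<in> C \<Longrightarrow> card (Q c) = m" by metis
  obtain B0 :: "nat set set" where B0: "is_packing 4 {0..<\<rho>} B0" "card B0 = D \<rho> 4"
    using D_attained by blast
  define blk where "blk = (\<lambda>(i, b). insert (N + i) (f ` b))"
  define I where "I = Sigma {0..<\<rho>} (\<lambda>i. Q (h i))"
  define B1 where "B1 = blk ` I"
  define B2 where "B2 = image ((+) N) ` B0"
  have IV: "i < \<rho>" "b \<in> P (h i)" "b \<subseteq> V" "card b = 3" if "(i, b) \<in> I" for i b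
    using that Q(2) PV P3 hC unfolding I_def by (auto, blast+)
  have fb: "f x < N" if "(i, b) \<in> I" "x \<in> b" for i b x
    using IV(3)[OF that(1)] that(2) f(1) by (auto simp: image_subset_iff)
  have fb': "N + k \<notin> f ` b" if "(i, b) \<in> I" for i b k
    using fb[OF that] by fastforce
  have fin3: "finite b" if "(i, b) \<in> I" for i b
    using IV(4)[OF that] by (intro card_ge_0_finite) simp
  have blk_eq: "i = j \<and> b = c" if "(i, b) \<in> I" "(j, c) \<in> I" "blk (i, b) = blk (j, c)" for i j b c
  proof -
    \<comment> \<open>The triple is read off from the points below \<open>N\<close>, the index from
      the single point that is not below \<open>N\<close>.\<close>
    have low: "blk (k, d) \<inter> {0..<N} = f ` d" if "(k, d) \<in> I" for k d
      using fb[OF that] by (auto simp: blk_def)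
    have "f ` b = f ` c" using low[OF that(1)] low[OF that(2)] that(3) by simp
    then have "b = c"
      using inj_on_image_eq_iff[OF f(2) IV(3)[OF that(1)] IV(3)[OF that(2)]] by simp
    moreover have "N + i \<in> blk (j, c)" using that(3) by (auto simp: blk_def)
    then have "i = j" using fb'[OF that(2)] by (simp add: blk_def)
    ultimately show ?thesis by simp
  qed
  have card_blk: "card (blk p) = 4" if "p \<in> I" for p
  proof -
    obtain i b where p: "p = (i, b)" by fastforce
    have "card (f ` b) = 3"
      using IV(3,4)[of i b] that p f(2) by (metis card_image inj_on_subset)
    then show ?thesis using fin3 fb'[of i b] that p by (simp add: blk_def)
  qed
  have blk_int: "card (blk p \<inter> blk p') \<le> 1" if p: "p \<in> I" "p' \<in> I" "p \<noteq> p'" for p p'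
  proof -
    obtain i b j c where e: "p = (i, b)" "p' = (j, c)" by fastforce
    have ib: "(i, b) \<in> I" "(j, c) \<in> I" using p e by auto
    note A = IV[OF ib(1)] and A' = IV[OF ib(2)]
    have im: "f ` b \<inter> f ` c = f ` (b \<inter> c)"
      using inj_on_image_Int[OF f(2) A(3) A'(3)] by simp
    have fin: "finite (blk p \<inter> blk p')" using fin3 ib e by (simp add: blk_def)
    show ?thesis
    proof (cases "i = j")
      case True
      then have "b \<inter> c = {}" using Pd[OF hC[OF A(1)], of b c] A A' p e by auto
      then have "blk p \<inter> blk p' \<subseteq> {N + i}" using im fb'[OF ib(1)] fb'[OF ib(2)] e True
        unfolding blk_def by (simp; blast)
      then show ?thesis using card_mono[of "{N + i}" "blk p \<inter> blk p'"] by simp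
    next
      case False
      have "blk p \<inter> blk p' \<subseteq> f ` (b \<inter> c)" using im fb'[OF ib(1)] fb'[OF ib(2)] e False
        unfolding blk_def by (simp; blast)
      moreover have "x = y" if "x \<in> b \<inter> c" "y \<in> b \<inter> c" for x y
        using PP[OF hC[OF A(1)] hC[OF A'(1)] A(2) A'(2) hinj[OF A(1) A'(1) False] that] .
      ultimately show ?thesis using fin by (subst card_le_Suc0_iff_eq[simplified One_nat_def[symmetric]]) blast+
    qed
  qed
  have B0s: "b \<subseteq> {0..<\<rho>}" "card b = 4" "finite b" if "b \<in> B0" for b
    using B0(1) that unfolding is_packing_def by (auto intro: finite_subset)
  have B0i: "card (b \<inter> c) \<le> 1" if "b \<in> B0" "c \<in> B0" "b \<noteq> c" for b c
    using B0(1) that unfolding is_packing_def by blast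
  have injN: "inj ((+) N)" by simp
  have shift_int: "card ((+) N ` b \<inter> (+) N ` c) = card (b \<inter> c)" for b c :: "nat set"
    using card_image[OF inj_on_subset[OF injN], of "b \<inter> c"] image_Int[OF injN] by simp
  \<comment> \<open>A block built from a class has only one new point, and the shifted packing lives
    on new points.\<close>
  have mixed: "card (blk p \<inter> (+) N ` b) \<le> 1" if p: "p \<in> I" for p b
  proof -
    obtain i c where e: "p = (i, c)" by fastforce
    have "blk p \<inter> (+) N ` b \<subseteq> {N + i}" using fb[of i c] p e by (force simp: blk_def)
    then show ?thesis using card_mono[of "{N + i}"] by fastforce
  qed
  have fQ: "finite (Q (h i))" if "i < \<rho>" for i
    using Q(2) fP hC[OF that] finite_subset by blast
  then have fI: "finite I" unfolding I_def by (intro finite_SigmaI) auto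
  have fB0: "finite B0" using B0s(1) by (intro finite_subset[of B0 "Pow {0..<\<rho>}"]) auto
  have "card B1 = card I" unfolding B1_def
    by (rule card_image, rule inj_onI) (metis blk_eq surj_pair)
  also have "\<dots> = m * \<rho>" unfolding I_def using Q(3) hC fQ
    by (subst card_SigmaI) auto
  finally have cB1: "card B1 = m * \<rho>" .
  have cB2: "card B2 = D \<rho> 4" unfolding B2_def
    using card_image[OF inj_on_image[OF inj_on_subset[OF injN]], of B0] B0(2) by simp
  have disj: "B1 \<inter> B2 = {}"
  proof (rule ccontr)
    assume "B1 \<inter> B2 \<noteq> {}"
    then obtain p b where p: "p \<in> I" "blk p = (+) N ` b" by (auto simp: B1_def B2_def)
    then have "card (blk p \<inter> blk p) \<le> 1" using mixed[OF p(1), of b] by simp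
    then show False using card_blk[OF p(1)] by simp
  qed
  have pack: "is_packing 4 {0..<N + \<rho>} (B1 \<union> B2)"
    unfolding is_packing_def
  proof (intro conjI ballI impI)
    fix b assume "b \<in> B1 \<union> B2"
    then show "card b = 4"
      using card_blk B0s(2) shift_int[of b b] card_image[OF inj_on_subset[OF injN]]
      by (auto simp: B1_def B2_def)
    show "b \<subseteq> {0..<N + \<rho>}"
      using \<open>b \<in> B1 \<union> B2\<close>
    proof
      assume "b \<in> B1"
      then obtain i c where ic: "(i, c) \<in> I" "b = blk (i, c)" by (auto simp: B1_def)
      then show ?thesis using fb[OF ic(1)] IV(1)[OF ic(1)] by (fastforce simp: blk_def)
    next
      assume "b \<in> B2"
      then show ?thesis using B0s(1) by (fastforce simp: B2_def)
    qed
  next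
    fix b c assume bc: "b \<in> B1 \<union> B2" "c \<in> B1 \<union> B2" "b \<noteq> c"
    consider "b \<in> B1" "c \<in> B1" | "b \<in> B1" "c \<in> B2" | "b \<in> B2" "c \<in> B1" | "b \<in> B2" "c \<in> B2"
      using bc by blast
    then show "card (b \<inter> c) \<le> 1"
    proof cases
      case 1 then show ?thesis using blk_int bc(3) by (auto simp: B1_def)
    next
      case 2 then show ?thesis using mixed by (auto simp: B1_def B2_def)
    next
      case 3 then show ?thesis using mixed by (auto simp: B1_def B2_def Int_commute)
    next
      case 4
      then obtain b' c' where "b' \<in> B0" "c' \<in> B0" "b = (+) N ` b'" "c = (+) N ` c'"
        by (auto simp: B2_def)
      then show ?thesis using B0i[of b' c'] shift_int[of b' c'] bc(3) by metis
    qed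
  qed simp
  have meets: "b \<inter> {N..<N + \<rho>} \<noteq> {}" if "b \<in> B1 \<union> B2" for b
    using that
  proof
    assume "b \<in> B1"
    then obtain i c where ic: "(i, c) \<in> I" "b = blk (i, c)" by (auto simp: B1_def)
    then have "N + i \<in> b \<inter> {N..<N + \<rho>}" using IV(1) by (auto simp: blk_def)
    then show ?thesis by blast
  next
    assume "b \<in> B2"
    then obtain c where c: "c \<in> B0" "b = (+) N ` c" by (auto simp: B2_def)
    moreover obtain x where "x \<in> c" using B0s(2)[OF c(1)] by fastforce
    ultimately have "N + x \<in> b \<inter> {N..<N + \<rho>}" using B0s(1)[OF c(1)] by auto
    then show ?thesis by blast
  qed
  have "largest_ppc_size (B1 \<union> B2) \<rho>"
    unfolding largest_ppc_size_def
  proof (intro conjI notI)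
    let ?g = "\<lambda>i. (i, R (h i))"
    let ?P = "(\<lambda>i. blk (?g i)) ` {0..<\<rho>}"
    have gI: "?g i \<in> I" if "i < \<rho>" for i using that Q(1) hC by (auto simp: I_def)
    have dis: "blk (?g i) \<inter> blk (?g j) = {}" if ij: "i < \<rho>" "j < \<rho>" "i \<noteq> j" for i j
    proof -
      have "R (h i) \<inter> R (h j) = {}" using Rd hC hinj ij by blast
      then have "f ` R (h i) \<inter> f ` R (h j) = {}"
        using inj_on_image_Int[OF f(2) IV(3)[OF gI[OF ij(1)]] IV(3)[OF gI[OF ij(2)]]] by simp
      then show ?thesis using fb'[OF gI[OF ij(1)]] fb'[OF gI[OF ij(2)]] ij(3)
        by (simp add: blk_def)
    qed
    have "inj_on (\<lambda>i. blk (?g i)) {0..<\<rho>}"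
      using blk_eq gI by (intro inj_onI) (metis atLeastLessThan_iff)
    then have "card ?P = \<rho>" by (simp add: card_image)
    moreover have "is_ppc (B1 \<union> B2) ?P"
      unfolding is_ppc_def B1_def using gI dis by fastforce
    ultimately show "\<exists>P. is_ppc (B1 \<union> B2) P \<and> card P = \<rho>" by blast
  next
    assume "\<exists>P. is_ppc (B1 \<union> B2) P \<and> card P = \<rho> + 1"
    then obtain P where P: "is_ppc (B1 \<union> B2) P" "card P = \<rho> + 1" by blast
    have "card P \<le> card {N..<N + \<rho>}"
      using P(1) meets unfolding is_ppc_def by (intro card_disjoint_family_le) blast+
    then show False using P(2) by simp
  qed
  moreover have "card (B1 \<union> B2) = m * \<rho> + D \<rho> 4"
    using card_Un_disjoint[OF _ _ disj] fI fB0 cB1 cB2 by (simp add: B1_def B2_def)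
  moreover have "card {0..<N + \<rho>} = 3 * m + 2 + \<rho>" by (simp add: N_def)
  ultimately show ?thesis using pack by metis
qed

lemma card_triple: "a \<noteq> b \<Longrightarrow> a \<noteq> c \<Longrightarrow> b \<noteq> c \<Longrightarrow> card {a, b, c} = 3"
  by simp

section \<open>Orthogonal Latin squares with a common transversal\<close>

text \<open>\<open>Y\<close> and \<open>Z\<close> are Latin squares with rows \<open>x\<close> and
  columns \<open>t\<close>, and \<open>yz\<close> together with \<open>ty\<close> makes them
  orthogonal. The cells \<open>(x, \<theta> x)\<close> form a common transversal, which yields the
  rainbow matching. As \<open>X\<close> misses at most one row, the
  \<open>card X + 2 * card G\<close> points respect the bound \<open>3 * card X + 2\<close>.\<close>

lemma rainbow_classes_of_latin_squares:
  fixes G X :: "'a set" and Y Z :: "'a \<Rightarrow> 'a \<Rightarrow> 'a" and \<theta> :: "'a \<Rightarrow> 'a"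
  assumes "finite G" "X \<subseteq> G" "card G \<le> card X + 1"
    and YG: "\<And>x t. x \<in> G \<Longrightarrow> t \<in> G \<Longrightarrow> Y x t \<in> G"
    and ZG: "\<And>x t. x \<in> G \<Longrightarrow> t \<in> G \<Longrightarrow> Z x t \<in> G"
    and xy: "\<And>x t t'. x \<in> G \<Longrightarrow> t \<in> G \<Longrightarrow> t' \<in> G \<Longrightarrow> Y x t = Y x t' \<Longrightarrow> t = t'"
    and xz: "\<And>x t t'. x \<in> G \<Longrightarrow> t \<in> G \<Longrightarrow> t' \<in> G \<Longrightarrow> Z x t = Z x t' \<Longrightarrow> t = t'"
    and ty: "\<And>x x' t. x \<in> G \<Longrightarrow> x' \<in> G \<Longrightarrow> t \<in> G \<Longrightarrow> Y x t = Y x' t \<Longrightarrow> x = x'"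
    and tz: "\<And>x x' t. x \<in> G \<Longrightarrow> x' \<in> G \<Longrightarrow> t \<in> G \<Longrightarrow> Z x t = Z x' t \<Longrightarrow> x = x'"
    and yz: "\<And>x x' t t'. x \<in> G \<Longrightarrow> x' \<in> G \<Longrightarrow> t \<in> G \<Longrightarrow> t' \<in> G \<Longrightarrow>
               Y x t = Y x' t' \<Longrightarrow> Z x t = Z x' t' \<Longrightarrow> t = t'"
    and \<theta>G: "\<And>x. x \<in> G \<Longrightarrow> \<theta> x \<in> G" and \<theta>: "inj_on \<theta> G"
    and \<theta>Y: "inj_on (\<lambda>x. Y x (\<theta> x)) G" and \<theta>Z: "inj_on (\<lambda>x. Z x (\<theta> x)) G"
  shows "\<exists>V C P R. rainbow_classes (card X) (V :: (nat \<times> 'a) set) (C :: 'a set) P R"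
proof -
  define T where "T = (\<lambda>t x. {(0 :: nat, x), (1, Y x t), (2, Z x t)})"
  define V where "V = {0 :: nat} \<times> X \<union> {1, 2} \<times> G"
  define R where "R = (\<lambda>t. T t (the_inv_into X \<theta> t))"
  have fX: "finite X" using assms(1,2) finite_subset by blast
  have \<theta>X: "inj_on \<theta> X" using \<theta> \<open>X \<subseteq> G\<close> inj_on_subset by blast
  have tG: "t \<in> G" if "t \<in> \<theta> ` X" for t using that \<theta>G \<open>X \<subseteq> G\<close> by auto
  have XG: "x \<in> G" if "x \<in> X" for x using that \<open>X \<subseteq> G\<close> by auto
  have same: "x = x'" if "t \<in> \<theta> ` X" "x \<in> X" "x' \<in> X" "p \<in> T t x" "p \<in> T t x'" for t x x' p
    using that(4,5) ty[OF XG XG tG, OF that(2,3,1)] tz[OF XG XG tG, OF that(2,3,1)]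
    unfolding T_def by auto
  have inv: "the_inv_into X \<theta> t \<in> X" "\<theta> (the_inv_into X \<theta> t) = t" if "t \<in> \<theta> ` X" for t
    using that the_inv_into_into[OF \<theta>X] f_the_inv_into_f[OF \<theta>X] by auto
  \<comment> \<open>The classes are the columns that the transversal meets in the rows of
    \<open>X\<close>; deleting a row thus deletes one class and leaves the matching
    complete.\<close>
  have "rainbow_classes (card X) V (\<theta> ` X) (\<lambda>t. T t ` X) R"
  proof (rule rainbow_classesI)
    show "finite V" using fX assms(1) by (simp add: V_def)
    have "card V \<le> card X + 2 * card G"
      unfolding V_def by (rule order_trans[OF card_Un_le]) (simp add: card_cartesian_product)
    then show "card V \<le> 3 * card X + 2" using assms(3) by simp
    show "finite (\<theta> ` X)" using fX by simp
    show "card X \<le> card (\<theta> ` X)" using \<theta>X by (simp add: card_image)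
  next
    fix t assume t: "t \<in> \<theta> ` X"
    show "finite (T t ` X)" using fX by simp
    have "inj_on (T t) X"
      using same[OF t] by (intro inj_onI) (metis T_def insertI1)
    then show "card X \<le> card (T t ` X)" by (simp add: card_image)
    show "R t \<in> T t ` X" using inv(1)[OF t] by (simp add: R_def)
  next
    fix t b assume t: "t \<in> \<theta> ` X" "b \<in> T t ` X"
    then show "b \<subseteq> V" using YG ZG XG tG by (auto simp: T_def V_def)
    show "card b = 3" using t by (auto simp: T_def)
  next
    fix t b b' p assume "t \<in> \<theta> ` X" "b \<in> T t ` X" "b' \<in> T t ` X" "p \<in> b" "p \<in> b'"
    then show "b = b'" using same by blast
  next
    fix t t' b b' p p'
    assume t: "t \<in> \<theta> ` X" "t' \<in> \<theta> ` X" "b \<in> T t ` X" "b' \<in> T t' ` X" "t \<noteq> t'"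
      and p: "p \<in> b" "p \<in> b'" "p' \<in> b" "p' \<in> b'"
    obtain x x' where x: "x \<in> X" "x' \<in> X" "b = T t x" "b' = T t' x'" using t by auto
    note G = XG[OF x(1)] XG[OF x(2)] tG[OF t(1)] tG[OF t(2)]
    \<comment> \<open>Any two of the three coordinates determine the class, so triples of different
      classes agree in at most one.\<close>
    have "\<not> (x = x' \<and> Y x t = Y x' t')" "\<not> (x = x' \<and> Z x t = Z x' t')"
        "\<not> (Y x t = Y x' t' \<and> Z x t = Z x' t')"
      using xy[OF G(1,3,4)] xz[OF G(1,3,4)] yz[OF G] t(5) by auto
    moreover have "v = (0, x) \<and> x = x' \<or> v = (1, Y x t) \<and> Y x t = Y x' t' \<or>
        v = (2, Z x t) \<and> Z x t = Z x' t'" if "v \<in> b" "v \<in> b'" for v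
      using that unfolding x T_def by auto
    ultimately show "p = p'" using p by metis
  next
    fix t t' p assume t: "t \<in> \<theta> ` X" "t' \<in> \<theta> ` X" and p: "p \<in> R t" "p \<in> R t'"
    define x where "x = the_inv_into X \<theta> t"
    define x' where "x' = the_inv_into X \<theta> t'"
    have x: "x \<in> G" "x' \<in> G" "\<theta> x = t" "\<theta> x' = t'"
      using inv t XG by (simp_all add: x_def x'_def)
    have "p \<in> T t x" "p \<in> T t' x'" using p by (simp_all add: R_def x_def x'_def)
    then have "x = x' \<or> Y x t = Y x' t' \<or> Z x t = Z x' t'" by (auto simp: T_def)
    then have "x = x'" using x inj_onD[OF \<theta>Y, of x x'] inj_onD[OF \<theta>Z, of x x'] by auto
    then show "t = t'" using x by simp
  qed
  then show ?thesis by blast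
qed

lemma eq_if_dvd_diff:
  fixes q :: int
  assumes "q dvd s - s'" "s \<in> {0..<q}" "s' \<in> {0..<q}"
  shows "s = s'"
  using assms by (metis atLeastLessThan_iff mod_eq_dvd_iff mod_pos_pos_trivial)

text \<open>Invertibility of 2 separates the classes, since the second and third coordinates add up
  to \<open>2 * t\<close>, and makes \<open>\<theta>\<close> injective. Along the transversal these
  coordinates are \<open>3 * x\<close> and \<open>x\<close>, so 3 has to be invertible as
  well.\<close>

lemma rainbow_classes_cyclic:
  fixes q :: nat
  assumes "coprime q 6" "X \<subseteq> {0..<int q}" "q \<le> card X + 1"
  shows "\<exists>V C P R. rainbow_classes (card X) (V :: (nat \<times> int) set) (C :: int set) P R"
proof (rule rainbow_classes_of_latin_squares[where G = "{0..<int q}" and Y = "\<lambda>x t. (x + t) mod int q"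
        and Z = "\<lambda>x t. (t - x) mod int q" and \<theta> = "\<lambda>x. (2 * x) mod int q"])
  have "q \<noteq> 0" using assms(1) by (intro notI) simp
  then have q: "0 < int q" by simp
  have "coprime (int q) 6" using assms(1) by (metis coprime_int_iff of_nat_numeral)
  then have c: "coprime (int q) 2" "coprime (int q) 3"
    by (auto intro: coprime_divisors[of "int q" "int q" _ 6])
  have c2: "int q dvd d" if "int q dvd 2 * d" for d
    using that c(1) by (simp add: coprime_dvd_mult_right_iff)
  have c3: "int q dvd d" if "int q dvd 3 * d" for d
    using that c(2) by (simp add: coprime_dvd_mult_right_iff)
  show "t = t'" if "t \<in> {0..<int q}" "t' \<in> {0..<int q}" "(x + t) mod int q = (x + t') mod int q" for x t t'
    using that eq_if_dvd_diff[of "int q" t t'] by (simp add: mod_eq_dvd_iff)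
  show "t = t'" if "t \<in> {0..<int q}" "t' \<in> {0..<int q}" "(t - x) mod int q = (t' - x) mod int q" for x t t'
    using that eq_if_dvd_diff[of "int q" t t'] by (simp add: mod_eq_dvd_iff)
  \<comment> \<open>In this goal and the next, \<open>t\<close> and \<open>t'\<close> are first
    coordinates and \<open>x\<close> is the class.\<close>
  show "t = t'" if "t \<in> {0..<int q}" "t' \<in> {0..<int q}" "(t + x) mod int q = (t' + x) mod int q" for x t t'
    using that eq_if_dvd_diff[of "int q" t t'] by (simp add: mod_eq_dvd_iff)
  show "t = t'" if "t \<in> {0..<int q}" "t' \<in> {0..<int q}" "(x - t) mod int q = (x - t') mod int q" for x t t'
    using that eq_if_dvd_diff[of "int q" t' t] by (simp add: mod_eq_dvd_iff)
  show "t = t'" if "t \<in> {0..<int q}" "t' \<in> {0..<int q}"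
    "(x + t) mod int q = (x' + t') mod int q" "(t - x) mod int q = (t' - x') mod int q" for x x' t t'
  proof -
    have "int q dvd (x + t - (x' + t')) + (t - x - (t' - x'))"
      using that(3,4) unfolding mod_eq_dvd_iff by (rule dvd_add)
    also have "\<dots> = 2 * (t - t')" by simp
    finally show ?thesis using c2 eq_if_dvd_diff that(1,2) by blast
  qed
  show "inj_on (\<lambda>x. (2 * x) mod int q) {0..<int q}"
    using c2 eq_if_dvd_diff by (intro inj_onI) (metis mod_eq_dvd_iff right_diff_distrib)
  have "(x + 2 * x mod int q) mod int q = (3 * x) mod int q" for x
    by (simp add: mod_add_right_eq)
  then show "inj_on (\<lambda>x. (x + 2 * x mod int q) mod int q) {0..<int q}"
    using c3 eq_if_dvd_diff by (intro inj_onI) (metis mod_eq_dvd_iff right_diff_distrib)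
  have "(2 * x mod int q - x) mod int q = x mod int q" for x
    by (simp add: mod_diff_left_eq)
  then show "inj_on (\<lambda>x. (2 * x mod int q - x) mod int q) {0..<int q}"
    using eq_if_dvd_diff by (intro inj_onI) simp
qed (use assms in auto)

text \<open>Pairs of bits with exclusive or encode the field of order 4. In characteristic 2 the
  maps \<open>x + t\<close> and \<open>t - x\<close> coincide, so \<open>Z\<close> is
  \<open>x + w * t\<close> instead, where the primitive element \<open>w\<close> takes
  \<open>(a, b)\<close> to \<open>(b, a + b)\<close>; \<open>\<theta>\<close> is multiplication by
  \<open>w\<close>. Along the transversal the coordinates become \<open>w^2 * x\<close> and
  \<open>w * x\<close>. Removing zero leaves 3 + 4 + 4 points.\<close>

lemma rainbow_classes_3: "\<exists>V C P R. rainbow_classes 3 (V :: (nat \<times> bool \<times> bool) set) (C :: (bool \<times> bool) set) P R"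
proof -
  have U: "(UNIV :: (bool \<times> bool) set) = {(False, False), (False, True), (True, False), (True, True)}"
    by auto
  have "\<exists>V C P R. rainbow_classes (card (UNIV - {(False, False)})) (V :: (nat \<times> bool \<times> bool) set) (C :: (bool \<times> bool) set) P R"
    by (rule rainbow_classes_of_latin_squares[where G = UNIV
          and Y = "\<lambda>x t. (fst x \<noteq> fst t, snd x \<noteq> snd t)"
          and Z = "\<lambda>x t. (fst x \<noteq> snd t, snd x \<noteq> (fst t \<noteq> snd t))"
          and \<theta> = "\<lambda>x. (snd x, fst x \<noteq> snd x)"])
      (auto simp: inj_on_def)
  then show ?thesis by (simp add: U card_insert_if numeral_3_eq_3)
qed

text \<open>Doubling fails in characteristic 3 because \<open>x + 2 * x\<close> vanishes. Instead
  \<open>\<theta>\<close> is multiplication by an element \<open>w\<close> of the field of order 9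
  with \<open>w^2 = w + 1\<close>; as \<open>w\<close> is none of 0, 1, -1, the maps
  \<open>w * x\<close>, \<open>x + w * x\<close> and \<open>w * x - x\<close> are injective.\<close>

lemma rainbow_classes_field_9:
  fixes X :: "(int \<times> int) set"
  assumes "X \<subseteq> {0..<3} \<times> {0..<3}" "8 \<le> card X"
  shows "\<exists>V C P R. rainbow_classes (card X) (V :: (nat \<times> int \<times> int) set) (C :: (int \<times> int) set) P R"
proof (rule rainbow_classes_of_latin_squares[where G = "{0..<3} \<times> {0..<3}"
        and Y = "\<lambda>x t. ((fst x + fst t) mod 3, (snd x + snd t) mod 3)"
        and Z = "\<lambda>x t. ((fst t - fst x) mod 3, (snd t - snd x) mod 3)"
        and \<theta> = "\<lambda>x. (snd x, (fst x + snd x) mod 3)"])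
  have add: "t = t'" if "t \<in> {0..<3}" "t' \<in> {0..<3}" "(x + t) mod 3 = (x + t') mod 3" for x t t' :: int
    using that eq_if_dvd_diff[of 3 t t'] by (simp add: mod_eq_dvd_iff)
  have diff: "t = t'" if "t \<in> {0..<3}" "t' \<in> {0..<3}" "(x - t) mod 3 = (x - t') mod 3" for x t t' :: int
    using that eq_if_dvd_diff[of 3 t' t] by (simp add: mod_eq_dvd_iff)
  have both: "t = t'" if "t \<in> {0..<3}" "t' \<in> {0..<3}" "(x + t) mod 3 = (x' + t') mod 3"
    "(t - x) mod 3 = (t' - x') mod 3" for x x' t t' :: int
  proof -
    have "3 dvd (x + t - (x' + t')) + (t - x - (t' - x'))"
      using that(3,4) unfolding mod_eq_dvd_iff by (rule dvd_add)
    then have "3 dvd t - t'" by presburger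
    then show ?thesis using that(1,2) by (rule eq_if_dvd_diff)
  qed
  let ?G = "{0..<3 :: int} \<times> {0..<3 :: int}"
  show "t = t'" if "t \<in> ?G" "t' \<in> ?G" "((fst x + fst t) mod 3, (snd x + snd t) mod 3) =
    ((fst x + fst t') mod 3, (snd x + snd t') mod 3)" for x t t' :: "int \<times> int"
    using that unfolding mem_Times_iff prod_eq_iff[of t] prod.inject by (metis add)
  show "t = t'" if "t \<in> ?G" "t' \<in> ?G" "((fst t - fst x) mod 3, (snd t - snd x) mod 3) =
    ((fst t' - fst x) mod 3, (snd t' - snd x) mod 3)" for x t t' :: "int \<times> int"
    using that unfolding mem_Times_iff prod_eq_iff[of t] prod.inject by (metis add uminus_add_conv_diff)
  show "x = x'" if "x \<in> ?G" "x' \<in> ?G" "((fst x + fst t) mod 3, (snd x + snd t) mod 3) =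
    ((fst x' + fst t) mod 3, (snd x' + snd t) mod 3)" for x x' t :: "int \<times> int"
    using that unfolding mem_Times_iff prod_eq_iff[of x] prod.inject by (metis add add.commute)
  show "x = x'" if "x \<in> ?G" "x' \<in> ?G" "((fst t - fst x) mod 3, (snd t - snd x) mod 3) =
    ((fst t - fst x') mod 3, (snd t - snd x') mod 3)" for x x' t :: "int \<times> int"
    using that unfolding mem_Times_iff prod_eq_iff[of x] prod.inject by (metis diff)
  show "t = t'" if "t \<in> ?G" "t' \<in> ?G"
    "((fst x + fst t) mod 3, (snd x + snd t) mod 3) = ((fst x' + fst t') mod 3, (snd x' + snd t') mod 3)"
    "((fst t - fst x) mod 3, (snd t - snd x) mod 3) = ((fst t' - fst x') mod 3, (snd t' - snd x') mod 3)"
    for x x' t t' :: "int \<times> int"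
    using that unfolding mem_Times_iff prod_eq_iff[of t] prod.inject by (metis both)
  show "inj_on (\<lambda>x. (snd x, (fst x + snd x) mod 3)) ?G"
    by (rule inj_onI) (unfold mem_Times_iff prod_eq_iff prod.sel, metis add add.commute)
  show "inj_on (\<lambda>x. ((fst x + fst (snd x, (fst x + snd x) mod 3)) mod 3,
       (snd x + snd (snd x, (fst x + snd x) mod 3)) mod 3)) ?G"
    by (rule inj_onI) (unfold mem_Times_iff prod_eq_iff prod.sel, metis add add.commute)
  \<comment> \<open>The second entry of the third coordinate recovers \<open>fst x\<close>, after
    which the first entry recovers \<open>snd x\<close>.\<close>
  have "((a + b) mod 3 - b) mod 3 = a" if "a \<in> {0..<3}" for a b :: int
    using that by (simp add: mod_diff_left_eq)
  then show "inj_on (\<lambda>x. ((fst (snd x, (fst x + snd x) mod 3) - fst x) mod 3,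
       (snd (snd x, (fst x + snd x) mod 3) - snd x) mod 3)) ?G"
    by (intro inj_onI) (unfold mem_Times_iff prod_eq_iff prod.sel, metis add uminus_add_conv_diff)
  show "card ?G \<le> card X + 1" using assms(2) by (simp add: card_cartesian_product)
qed (simp_all add: assms(1) mem_Times_iff)

section \<open>Adding points to the cyclic construction\<close>

text \<open>
  Five points \<open>(3, 0), ..., (3, 4)\<close> are added. In class \<open>s\<close> the first coordinates of the triples
  \<open>a = 1, 4, 8\<close> give way to \<open>(3, 0), (3, 1), (3, 2)\<close> and form a triple \<open>W s\<close> of their own, a net gain of
  one triple. Its differences 3, 4, 7 avoid the differences 1, 2 of the blocks of consecutive
  residues that make up most of the additional class \<open>q\<close>.
\<close>

lemma rainbow_classes_add_points:
  fixes q :: int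
  assumes "q mod 6 = 1" "q \<ge> 13"
  shows "\<exists>V C P R. rainbow_classes (nat q + 1) (V :: (nat \<times> int) set) (C :: int set) P R"
proof -
  \<comment> \<open>Class \<open>s\<close> is the cyclic class \<open>t = 2 * s\<close>, and
    \<open>a\<close> is the shift in \<open>x = s + a\<close>, so that the rainbow matching becomes
    \<open>a = 0\<close>.\<close>
  define X where "X = (\<lambda>s a. if a = 1 then (3 :: nat, 0) else if a = 4 then (3, 1)
      else if a = 8 then (3, 2) else (0, (s + a) mod q))"
  define T where "T = (\<lambda>s a. {X s a, (1, (3 * s + a) mod q), (2, (s - a) mod q)})"
  define W where "W = (\<lambda>s. {(0 :: nat, (s + 1) mod q), (0, (s + 4) mod q), (0, (s + 8) mod q)})"
  define H where "H = (\<lambda>(g :: nat, i :: int). {(g, 3 * i), (g, 3 * i + 1), (g, 3 * i + 2)})"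
  \<comment> \<open>Since 3 divides \<open>q - 1\<close>, consecutive blocks cover each copy except
    for its last residue; in the first copy this residue joins two added points. Altogether there
    are \<open>3 * (q div 3) + 2 = q + 1\<close> triples.\<close>
  define E where "E = {{(3 :: nat, 0), (3, 1), (3, 2)}, {(0, q - 1), (3, 3), (3, 4)}} \<union>
      H ` ({0, 1, 2} \<times> {0..<q div 3})"
  define P where "P = (\<lambda>s. if s = q then E else insert (W s) (T s ` {0..<q}))"
  \<comment> \<open>Triples of shift 0 contain no added point, so a triple of added points can
    represent class \<open>q\<close>.\<close>
  define R where "R = (\<lambda>s. if s = q then {(3, 0), (3, 1), (3, 2)} else T s 0)"
  define V where "V = {0 :: nat, 1, 2} \<times> {0..<q} \<union> {3} \<times> {0..<5}"
  have q14: "q \<noteq> 14" and q3: "q - 1 = 3 * (q div 3)" using assms by auto presburger+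
  have "q mod 2 = 1" "q mod 3 = 1" using assms(1) by presburger+
  then have cop: "coprime q 2" "coprime q 3" by (simp_all add: coprime_iff_gcd_eq_1 gcd_red_int[of q])
  have odd2: "q dvd d" if "q dvd 2 * d" for d
    using that cop(1) by (simp add: coprime_dvd_mult_right_iff)
  have odd3: "q dvd d" if "q dvd 3 * d" for d
    using that cop(2) by (simp add: coprime_dvd_mult_right_iff)
  have X0: "a = a' \<and> a \<in> {1, 4, 8} \<or> a \<notin> {1, 4, 8} \<and> a' \<notin> {1, 4, 8} \<and> q dvd s + a - (s' + a')"
    if "X s a = X s' a'" for s s' a a'
    using that by (auto simp: X_def mod_eq_dvd_iff split: if_splits)
  have X1: "fst (X s a) = 0 \<or> fst (X s a) = 3" for s a by (simp add: X_def)
  have share: "p = X s a \<and> X s a = X s' a' \<or>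
      p = (1, (3 * s + a) mod q) \<and> q dvd 3 * s + a - (3 * s' + a') \<or>
      p = (2, (s - a) mod q) \<and> q dvd s - a - (s' - a')"
    if "p \<in> T s a" "p \<in> T s' a'" for p s s' a a'
    using that X1[of s a] X1[of s' a'] unfolding T_def by (auto simp: mod_eq_dvd_iff)
  have TT: "a = a'" if "p \<in> T s a" "p \<in> T s a'" "a \<in> {0..<q}" "a' \<in> {0..<q}" for p s a a'
  proof -
    have "a = a' \<or> q dvd a - a' \<or> q dvd a' - a"
      using share[OF that(1,2)] X0[of s a s a'] by auto
    then show ?thesis using eq_if_dvd_diff that(3,4) by blast
  qed
  have TT': "p = p'" if p: "p \<in> T s a" "p \<in> T s' a'" "p' \<in> T s a" "p' \<in> T s' a'" "s \<noteq> s'"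
    and r: "a \<in> {0..<q}" "a' \<in> {0..<q}" "s \<in> {0..<q}" "s' \<in> {0..<q}" for p p' s s' a a'
  proof (rule ccontr)
    assume "p \<noteq> p'"
    let ?x = "X s a = X s' a'" and ?y = "q dvd 3 * s + a - (3 * s' + a')" and ?z = "q dvd s - a - (s' - a')"
    have "?x \<and> ?y \<or> ?x \<and> ?z \<or> ?y \<and> ?z"
      using share[OF p(1,2)] share[OF p(3,4)] \<open>p \<noteq> p'\<close> by auto
    \<comment> \<open>A shared first coordinate means equal shifts at an added point and congruent
      \<open>x\<close> otherwise. Combined with a second coordinate it shows that \<open>q\<close>
      divides 1, 2 or 3 times \<open>s - s'\<close>; the second and third coordinates together give
      4 times \<open>s - s'\<close>.\<close>
    moreover have "q dvd s - s'" if "?x" "?y"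
    proof (cases "a = a'")
      case True then show ?thesis using that(2) odd3[of "s - s'"] by (simp add: algebra_simps)
    next
      case False
      then have "q dvd (3 * s + a - (3 * s' + a')) - (s + a - (s' + a'))"
        using X0[OF that(1)] that(2) by (blast intro: dvd_diff)
      then show ?thesis using odd2[of "s - s'"] by (simp add: algebra_simps)
    qed
    moreover have "q dvd s - s'" if "?x" "?z"
    proof (cases "a = a'")
      case True then show ?thesis using that(2) by simp
    next
      case False
      then have "q dvd (s - a - (s' - a')) + (s + a - (s' + a'))"
        using X0[OF that(1)] that(2) by (blast intro: dvd_add)
      then show ?thesis using odd2[of "s - s'"] by (simp add: algebra_simps)
    qed
    moreover have "q dvd s - s'" if "?y" "?z"
    proof -
      have "q dvd (3 * s + a - (3 * s' + a')) + (s - a - (s' - a'))"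
        using that by (rule dvd_add)
      then show ?thesis using odd2[of "s - s'"] odd2[of "2 * (s - s')"] by (simp add: algebra_simps)
    qed
    ultimately show False using eq_if_dvd_diff r(3,4) \<open>s \<noteq> s'\<close> by blast
  qed
  \<comment> \<open>In absolute value, a difference of two differences among 1, 4, 8 can be 14 but
    not 13, so even \<open>q = 13\<close> divides none but 0.\<close>
  have small: "d = 0" if "q dvd d" "\<bar>d\<bar> \<le> 12 \<or> \<bar>d\<bar> = 14" for d
  proof (rule ccontr)
    assume "d \<noteq> 0"
    then have "q \<le> \<bar>d\<bar>" using that(1) by (simp add: zdvd_imp_le)
    then have "q = 13" "d = 14 \<or> d = -14" using that(2) assms(2) q14 by auto
    then show False using that(1) by auto
  qed
  have TW: "p \<notin> T s a" if "p \<in> W s" "a \<in> {0..<q}" for p s a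
  proof
    assume "p \<in> T s a"
    then have "p = X s a" "fst (X s a) = 0" using that(1) X1[of s a] by (auto simp: T_def W_def)
    then have "a \<notin> {1, 4, 8}" "\<exists>c\<in>{1, 4, 8}. (s + a) mod q = (s + c) mod q"
      using that(1) by (auto simp: X_def W_def split: if_splits)
    then obtain c where "c \<in> {1, 4, 8}" "q dvd a - c" "a \<noteq> c" by (auto simp: mod_eq_dvd_iff)
    then show False using eq_if_dvd_diff[of q a c] that(2) assms(2) by auto
  qed
  have T0: "p = X s a" if "p \<in> T s a" "fst p = 0 \<or> fst p = 3" for p s a
    using that by (auto simp: T_def)
  have W0: "fst p = 0" if "p \<in> W s" for p s using that by (auto simp: W_def)
  have memW: "\<exists>c\<in>{1, 4, 8}. p = (0, (s + c) mod q)" if "p \<in> W s" for p s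
    using that by (auto simp: W_def)
  have WW: "p = p'" if "p \<in> W s" "p \<in> W s'" "p' \<in> W s" "p' \<in> W s'" "s \<noteq> s'" "s \<in> {0..<q}" "s' \<in> {0..<q}"
    for p p' s s'
  proof (rule ccontr)
    assume "p \<noteq> p'"
    note mem = memW[OF that(1)] memW[OF that(2)] memW[OF that(3)] memW[OF that(4)]
    obtain c c' d d' where c: "c \<in> {1, 4, 8}" "c' \<in> {1, 4, 8}" "d \<in> {1, 4, 8}" "d' \<in> {1, 4, 8}"
      and e: "p = (0, (s + c) mod q)" "p = (0, (s' + c') mod q)" "p' = (0, (s + d) mod q)" "p' = (0, (s' + d') mod q)"
      using mem by metis
    have "c \<noteq> d" using e(1,3) \<open>p \<noteq> p'\<close> by blast
    moreover have "(s + c) mod q = (s' + c') mod q" "(s + d) mod q = (s' + d') mod q" using e by simp_all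
    ultimately have cd: "c \<noteq> d" "q dvd s + c - (s' + c')" "q dvd s + d - (s' + d')"
      by (simp_all add: mod_eq_dvd_iff)
    then have "q dvd (s + c - (s' + c')) - (s + d - (s' + d'))" by (blast intro: dvd_diff)
    then have "q dvd (c - c') - (d - d')" by (simp add: algebra_simps)
    then have "(c - c') - (d - d') = 0" using c by (intro small) auto
    \<comment> \<open>The six nonzero differences among 1, 4, 8 are distinct, so equal differences
      come from the same pair.\<close>
    then have "c = c'" using c cd(1) by auto
    then have "s = s'" using cd(2) eq_if_dvd_diff that(6,7) by auto
    then show False using that(5) by simp
  qed
  \<comment> \<open>A triple \<open>T s a\<close> has one point in copy 1, one in copy 2 and one in
    copies 0 and 3 together; hence it meets a block of \<open>E\<close> at most once.\<close>
  have EP: "fst p = fst p' \<or> (fst p \<in> {0, 3} \<and> fst p' \<in> {0, 3})" if "b \<in> E" "p \<in> b" "p' \<in> b" for b p p'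
    using that by (auto simp: E_def H_def)
  have ET: "p = p'" if "b \<in> E" "p \<in> b" "p' \<in> b" "p \<in> T s a" "p' \<in> T s a" for b p p' s a
    using EP[OF that(1-3)] that(4,5) X1[of s a] unfolding T_def by auto
  have EW: "p = p'" if "b \<in> E" "p \<in> b" "p' \<in> b" "p \<in> W s" "p' \<in> W s" for b p p' s
  proof (rule ccontr)
    assume "p \<noteq> p'"
    note mem = memW[OF that(4)] memW[OF that(5)]
    obtain c d where c: "c \<in> {1, 4, 8}" "d \<in> {1, 4, 8}" "p = (0, (s + c) mod q)" "p' = (0, (s + d) mod q)"
      using mem by metis
    have e: "c \<noteq> d" "(s + c) mod q \<noteq> (s + d) mod q" using c \<open>p \<noteq> p'\<close> by auto
    \<comment> \<open>Blocks of \<open>E\<close> do not wrap around, so their points in copy 0 are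
      at most 2 apart as integers, against 3, 4 or 7 modulo \<open>q\<close> in
      \<open>W s\<close>.\<close>
    have "\<bar>(s + c) mod q - (s + d) mod q\<bar> \<le> 2"
      using that(1-3) c(3,4) e(2) unfolding E_def H_def by auto
    moreover have "q dvd ((s + c) mod q - (s + d) mod q) - (c - d)"
      by (metis (no_types) add_diff_cancel_left mod_diff_eq mod_eq_dvd_iff)
    ultimately have "((s + c) mod q - (s + d) mod q) - (c - d) = 0"
      using c(1,2) by (intro small) auto
    then show False using c(1,2) e(1) \<open>\<bar>_\<bar> \<le> 2\<close> by auto
  qed
  have HH: "z = z'" if "p \<in> H z" "p \<in> H z'" for p z z'
    using that unfolding H_def by (cases z; cases z') auto
  have L: "g \<noteq> 3 \<and> i < q - 1" if "(g, i) \<in> H z" "z \<in> {0, 1, 2} \<times> {0..<q div 3}" for g i z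
    using that q3 by (auto simp: H_def)
  have EE: "b = b'" if "b \<in> E" "b' \<in> E" "p \<in> b" "p \<in> b'" for b b' p
  proof -
    let ?F = "H ` ({0, 1, 2} \<times> {0..<q div 3})" and ?G = "{{(3, 0), (3, 1), (3, 2)}, {(0, q - 1), (3, 3), (3, 4)}}"
    have FG: False if "b \<in> ?F" "c \<in> ?G" "p \<in> b" "p \<in> c" for b c
    proof -
      have "fst p \<noteq> 3 \<and> snd p < q - 1" using that(1,3) L[of "fst p" "snd p"] by auto
      then show False using that(2,4) by auto
    qed
    have "b \<in> ?G \<or> b \<in> ?F" "b' \<in> ?G \<or> b' \<in> ?F" using that(1,2) unfolding E_def by simp_all
    then have "b \<in> ?F \<and> b' \<in> ?F \<or> b \<in> ?G \<and> b' \<in> ?G"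
      using FG[OF _ _ that(3,4)] FG[OF _ _ that(4,3)] by argo
    then consider "b \<in> ?F" "b' \<in> ?F" | "b \<in> ?G" "b' \<in> ?G" by argo
    then show ?thesis
    proof cases
      case 1
      then obtain z z' where z: "b = H z" "b' = H z'" by blast
      then have "z = z'" using HH[of p z z'] that(3,4) by simp
      then show ?thesis using z by simp
    next
      case 2 then show ?thesis using that(3,4) by auto
    qed
  qed
  have "rainbow_classes (nat q + 1) V {0..q} P R"
  proof (rule rainbow_classesI)
    show "finite V" by (simp add: V_def)
    have "card V \<le> card ({0 :: nat, 1, 2} \<times> {0..<q}) + card ({3 :: nat} \<times> {0..<5 :: int})"
      unfolding V_def by (rule card_Un_le)
    then show "card V \<le> 3 * (nat q + 1) + 2" by (simp add: card_cartesian_product)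
    show "finite {0..q}" "nat q + 1 \<le> card {0..q}" using assms(2) by simp_all
  next
    fix s assume "s \<in> {0..q}"
    show "finite (P s)" by (simp add: P_def E_def)
    show "R s \<in> P s" using assms(2) by (auto simp: R_def P_def E_def)
    show "nat q + 1 \<le> card (P s)"
    proof (cases "s = q")
      case True
      have inj: "inj_on H ({0, 1, 2} \<times> {0..<q div 3})"
        by (intro inj_onI) (metis (no_types, lifting) HH H_def insertI1 surj_pair case_prod_conv)
      have "3 * nat (q div 3) = nat q - 1" using q3 assms(2) by linarith
      then have "card (H ` ({0, 1, 2} \<times> {0..<q div 3})) = nat q - 1"
        using card_image[OF inj] by (simp add: card_cartesian_product)
      moreover have "card E = card {{(3 :: nat, 0), (3, 1), (3, 2)}, {(0, q - 1), (3, 3), (3, 4)}} +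
          card (H ` ({0, 1, 2} \<times> {0..<q div 3}))"
        unfolding E_def
      proof (rule card_Un_disjoint)
        have "(3, 0) \<notin> H z" "(3, 3) \<notin> H z" if "z \<in> {0, 1, 2} \<times> {0..<q div 3}" for z
          using L[OF _ that] by blast+
        then show "{{(3, 0), (3, 1), (3, 2)}, {(0, q - 1), (3, 3), (3, 4)}} \<inter> H ` ({0, 1, 2} \<times> {0..<q div 3}) = {}"
          by blast
      qed simp_all
      moreover have "card {{(3 :: nat, 0), (3, 1), (3, 2)}, {(0, q - 1), (3, 3), (3, 4)}} = 2"
        by (auto simp: card_insert_if)
      ultimately show ?thesis using True assms(2) by (simp add: P_def)
    next
      case False
      have "inj_on (T s) {0..<q}"
        by (intro inj_onI) (metis T_def TT insertI1)
      moreover have "W s \<notin> T s ` {0..<q}" using TW[of _ s] unfolding W_def by blast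
      ultimately show ?thesis using False assms(2) by (simp add: P_def card_image)
    qed
  next
    fix s b assume b: "s \<in> {0..q}" "b \<in> P s"
    have "b \<subseteq> V \<and> card b = 3" if "b \<in> E"
      using that q3 assms(2) by (auto simp: V_def E_def H_def)
    moreover have "W s \<subseteq> V" using assms(2) by (auto simp: V_def W_def)
    moreover have "card (W s) = 3"
      unfolding W_def using small[of "-3"] small[of "-7"] small[of "-4"]
      by (intro card_triple) (auto simp: mod_eq_dvd_iff)
    moreover have "T s a \<subseteq> V" for a using assms(2) by (auto simp: V_def T_def X_def)
    moreover have "card (T s a) = 3" for a
      unfolding T_def using X1[of s a] by (intro card_triple) (auto dest: arg_cong[where f = fst])
    ultimately show "b \<subseteq> V" "card b = 3" using b(2) by (auto simp: P_def split: if_splits)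
  next
    fix s b b' p assume b: "s \<in> {0..q}" "b \<in> P s" "b' \<in> P s" "p \<in> b" "p \<in> b'"
    show "b = b'"
    proof (cases "s = q")
      case True then show ?thesis using b EE by (simp add: P_def)
    next
      case False
      then have "b \<in> insert (W s) (T s ` {0..<q})" "b' \<in> insert (W s) (T s ` {0..<q})"
        using b by (simp_all add: P_def)
      then show ?thesis using b(4,5) by (elim insertE imageE; metis TT TW)
    qed
  next
    fix s s' b b' p p'
    assume s: "s \<in> {0..q}" "s' \<in> {0..q}" "b \<in> P s" "b' \<in> P s'" "s \<noteq> s'"
      and p: "p \<in> b" "p \<in> b'" "p' \<in> b" "p' \<in> b'"
    have WT: "p = p'" if "p \<in> W s" "p' \<in> W s" "p \<in> T s' a" "p' \<in> T s' a" for s s' a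
      using that W0 T0 by metis
    consider "s = q" | "s' = q" | "s \<in> {0..<q}" "s' \<in> {0..<q}" using s(1,2) by fastforce
    then show "p = p'"
    proof cases
      case 1
      then have "b \<in> E" "b' \<in> insert (W s') (T s' ` {0..<q})" using s by (auto simp: P_def)
      then show ?thesis using p ET EW by blast
    next
      case 2
      then have "b' \<in> E" "b \<in> insert (W s) (T s ` {0..<q})" using s by (auto simp: P_def)
      then show ?thesis using p ET EW by blast
    next
      case 3
      then have "b \<in> insert (W s) (T s ` {0..<q})" "b' \<in> insert (W s') (T s' ` {0..<q})"
        using s by (auto simp: P_def)
      then consider "b = W s" "b' = W s'" | a where "b = W s" "b' = T s' a"
        | a where "b = T s a" "b' = W s'"
        | a a' where "b = T s a" "b' = T s' a'" "a \<in> {0..<q}" "a' \<in> {0..<q}" by blast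
      then show ?thesis
      proof cases
        case 1 then show ?thesis using WW p s(5) \<open>s \<in> {0..<q}\<close> \<open>s' \<in> {0..<q}\<close> by metis
      next
        case 2 then show ?thesis using WT p by metis
      next
        case 3 then show ?thesis using WT p by metis
      next
        case 4 then show ?thesis using TT'[of p s a s' a' p'] p s(5) \<open>s \<in> {0..<q}\<close> \<open>s' \<in> {0..<q}\<close> by metis
      qed
    qed
  next
    fix s s' p assume s: "s \<in> {0..q}" "s' \<in> {0..q}" and p: "p \<in> R s" "p \<in> R s'"
    have T3: "fst p \<noteq> 3" if "p \<in> T s 0" for s using that by (auto simp: T_def X_def)
    show "s = s'"
    proof (cases "s = q \<or> s' = q")
      case True then show ?thesis using p T3 by (auto simp: R_def split: if_splits)
    next
      case False
      then have "p \<in> T s 0" "p \<in> T s' 0" "s \<in> {0..<q}" "s' \<in> {0..<q}" using p s by (auto simp: R_def)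
      moreover from this have "q dvd s - s' \<or> q dvd 3 * (s - s')"
        using share[of p s 0 s' 0] X0[of s 0 s' 0] by (auto simp: algebra_simps)
      ultimately show ?thesis using odd3 eq_if_dvd_diff by blast
    qed
  qed
  then show ?thesis by blast
qed

section \<open>Deleting points from the cyclic construction\<close>

text \<open>
  Class \<open>s\<close> is the class \<open>t = 2s\<close> of the cyclic construction. Deleting the points 0, 1, 2, 9 of the
  first copy frees four points in each of the other copies, and a triple of residues is formed from
  the freed points in each of them. The matching \<open>x = s\<close> loses the classes 0, 1, 2, 9; dropping the
  classes 2 and 9, it needs replacements in classes 0 and 1 on the uncovered residues
  0, 3, 6, 27 and 0, 1, 2, 9. In class 1 the freed points contain 0, 1, 2; in class 0 two more
  triples (\<open>x = 3, 6\<close>) are broken up to free 0, 3, 6.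
\<close>

lemma rainbow_classes_delete_points:
  fixes q :: int
  assumes "q mod 6 = 5" "q \<ge> 17"
  shows "\<exists>V C P R. rainbow_classes (nat q - 2) (V :: (nat \<times> int) set) (C :: int set) P R"
proof -
  \<comment> \<open>All these sets consist of first coordinates: \<open>A\<close> lists the triples
    that stay, while \<open>FY\<close> and \<open>FZ\<close> group broken-up ones whose second or
    third points form new triples. Class 0 breaks up six and regains four, any other class breaks up
    four and regains two, so each keeps \<open>q - 2\<close>.\<close>
  define A where "A = (\<lambda>s :: int. {0..<q} - {0, 1, 2, 9} - (if s = 0 then {3, 6} else {}))"
  define FY where "FY = (\<lambda>s :: int. if s = 0 then {{1, 2, 9}, {0, 3, 6}} else {{1, 2, 9 :: int}})"
  define FZ where "FZ = (\<lambda>s :: int. if s = 0 then {{0, 1, 2}, {3, 6, 9}}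
      else if s = 1 then {{0, 1, 2}} else {{0, 2, 9 :: int}})"
  define T where "T = (\<lambda>s x. {(0 :: nat, x), (1, (2 * s + x) mod q), (2, (2 * s - x) mod q)})"
  define U where "U = (\<lambda>s e. (1 :: nat, (2 * s + e) mod q))"
  define W where "W = (\<lambda>s e. (2 :: nat, (2 * s - e) mod q))"
  define P where "P = (\<lambda>s. T s ` A s \<union> image (U s) ` FY s \<union> image (W s) ` FZ s)"
  \<comment> \<open>\<open>U 0 e\<close> is the residue \<open>e\<close> and \<open>W 1 e\<close>
    the residue \<open>2 - e\<close>, so the two replacements cover 0, 3, 6 and 0, 1, 2.\<close>
  define R where "R = (\<lambda>s. if s = 0 then U s ` {0, 3, 6} else if s = 1 then W s ` {0, 1, 2} else T s s)"
  define C where "C = {0..<q} - {2, 9}"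
  define V where "V = {0 :: nat} \<times> ({0..<q} - {0, 1, 2, 9}) \<union> {1, 2} \<times> {0..<q}"
  have "q mod 2 = 1" "q mod 3 = 2" using assms(1) by presburger+
  then have cop: "coprime q 2" "coprime q 3" by (simp_all add: coprime_iff_gcd_eq_1 gcd_red_int[of q]
      gcd_red_int[of 3 2])
  have odd2: "q dvd d" if "q dvd 2 * d" for d
    using that cop(1) by (simp add: coprime_dvd_mult_right_iff)
  have odd3: "q dvd d" if "q dvd 3 * d" for d
    using that cop(2) by (simp add: coprime_dvd_mult_right_iff)
  have q18: "q \<noteq> 18" using assms(1) by auto
  \<comment> \<open>For two sets of \<open>FY\<close>, or two of \<open>FZ\<close>, a difference of
    differences may reach 18 (from \<open>{0, 2, 9}\<close>) but is never 17 in absolute value, so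
    even \<open>q = 17\<close> divides none but 0.\<close>
  have small: "d = 0" if "q dvd d" "\<bar>d\<bar> \<le> 16 \<or> \<bar>d\<bar> = 18" for d
  proof (rule ccontr)
    assume "d \<noteq> 0"
    then have "q \<le> \<bar>d\<bar>" using that(1) by (simp add: zdvd_imp_le)
    then have "q = 17" "d = 18 \<or> d = -18" using that(2) assms(2) q18 by auto
    then show False using that(1) by auto
  qed
  have CD: "s \<in> {0..<q}" if "s \<in> C" for s using that by (simp add: C_def)
  have AD: "x \<in> {0..<q}" if "x \<in> A s" for s x using that by (simp add: A_def)
  have FY0: "e \<in> {0..<q}" if "e \<in> E" "E \<in> FY s" for e E s
    using that assms(2) by (auto simp: FY_def split: if_splits)
  have FZ0: "e \<in> {0..<q}" if "e \<in> E" "E \<in> FZ s" for e E s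
    using that assms(2) by (auto simp: FZ_def split: if_splits)
  have AY: "x \<noteq> e" if "x \<in> A s" "e \<in> E" "E \<in> FY s" for x e E s
    using that by (auto simp: A_def FY_def split: if_splits)
  have AZ: "x \<noteq> e" if "x \<in> A s" "e \<in> E" "E \<in> FZ s" for x e E s
    using that by (auto simp: A_def FZ_def split: if_splits)
  have Uinj: "e = e'" if "U s e = U s e'" "e \<in> {0..<q}" "e' \<in> {0..<q}" for s e e'
    using that eq_if_dvd_diff[of q e e'] by (simp add: U_def mod_eq_dvd_iff)
  have Winj: "e = e'" if "W s e = W s e'" "e \<in> {0..<q}" "e' \<in> {0..<q}" for s e e'
    using that eq_if_dvd_diff[of q e' e] by (simp add: W_def mod_eq_dvd_iff)
  have TUW: "T s x = {(0, x), U s x, W s x}" for s x by (simp add: T_def U_def W_def)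
  have ne[simp]: "U s e \<noteq> W s' e'" "W s e \<noteq> U s' e'" "(0, x) \<noteq> U s e" "(0, x) \<noteq> W s e"
    "U s e \<noteq> (0, x)" "W s e \<noteq> (0, x)" for s e s' e' x
    by (simp_all add: U_def W_def)
  have eqs: "s = s'" if "q dvd 2 * (s - s')" "s \<in> C" "s' \<in> C" for s s'
    using that odd2 eq_if_dvd_diff CD by blast
  have TT: "x = x'" if "p \<in> T s x" "p \<in> T s x'" "x \<in> A s" "x' \<in> A s" for p s x x'
    using that Uinj[of s x x'] Winj[of s x x'] AD by (auto simp: TUW)
  have TT': "p = p'" if p: "p \<in> T s x" "p \<in> T s' x'" "p' \<in> T s x" "p' \<in> T s' x'" "s \<noteq> s'"
    and s: "s \<in> C" "s' \<in> C" for p p' s s' x x'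
  proof (rule ccontr)
    assume "p \<noteq> p'"
    let ?y = "U s x = U s' x'" and ?z = "W s x = W s' x'"
    have "x = x' \<and> ?y \<or> x = x' \<and> ?z \<or> ?y \<and> ?z"
      using p(1-4) \<open>p \<noteq> p'\<close> unfolding TUW by auto
    moreover have "q dvd 2 * (s - s')" if "x = x'" "?y"
      using that by (simp add: U_def mod_eq_dvd_iff right_diff_distrib)
    moreover have "q dvd 2 * (s - s')" if "x = x'" "?z"
      using that by (simp add: W_def mod_eq_dvd_iff right_diff_distrib)
    moreover have "q dvd 2 * (s - s')" if "?y" "?z"
    proof -
      have "q dvd (2 * s + x - (2 * s' + x')) + (2 * s - x - (2 * s' - x'))"
        using that by (intro dvd_add) (simp_all add: U_def W_def mod_eq_dvd_iff)
      then show ?thesis using odd2[of "2 * (s - s')"] by (simp add: algebra_simps)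
    qed
    ultimately show False using eqs s \<open>s \<noteq> s'\<close> by blast
  qed
  have UU: "E = E'" if m: "p \<in> U s ` E" "p \<in> U s ` E'" "E \<in> FY s" "E' \<in> FY s" for p s E E'
  proof -
    obtain e e' where e: "e \<in> E" "e' \<in> E'" "U s e = U s e'" using m(1,2) by (metis imageE)
    then have "e = e'" using Uinj FY0[OF _ that(3)] FY0[OF _ that(4)] by metis
    then have "e \<in> E" "e \<in> E'" using e by simp_all
    then show ?thesis using that(3,4) by (auto simp: FY_def split: if_splits)
  qed
  have WW: "E = E'" if m: "p \<in> W s ` E" "p \<in> W s ` E'" "E \<in> FZ s" "E' \<in> FZ s" for p s E E'
  proof -
    obtain e e' where e: "e \<in> E" "e' \<in> E'" "W s e = W s e'" using m(1,2) by (metis imageE)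
    then have "e = e'" using Winj FZ0[OF _ that(3)] FZ0[OF _ that(4)] by metis
    then have "e \<in> E" "e \<in> E'" using e by simp_all
    then show ?thesis using that(3,4) by (auto simp: FZ_def split: if_splits)
  qed
  \<comment> \<open>The differences of \<open>{1, 2, 9}\<close> are distinct and avoid 3 and 6. The
    set \<open>{0, 3, 6}\<close> repeats the difference 3, but it occurs in class 0 only.\<close>
  have KY: "\<forall>e\<in>E. \<forall>f\<in>E. \<forall>e'\<in>E'. \<forall>f'\<in>E'.
      \<bar>(e - f) - (e' - f')\<bar> \<le> 16 \<and> (e - f = e' - f' \<and> e \<noteq> f \<longrightarrow> e = e')"
    if m: "E \<in> FY s" "E' \<in> FY s'" "s \<noteq> s'" for E E' s s'
  proof -
    consider "E = {1, 2, 9}" "E' = {1, 2, 9}" | "E = {1, 2, 9}" "E' = {0, 3, 6}" | "E = {0, 3, 6}" "E' = {1, 2, 9}"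
      using m by (auto simp: FY_def split: if_splits)
    then show ?thesis by cases simp_all
  qed
  \<comment> \<open>The set \<open>{0, 1, 2}\<close> occurs in both classes 0 and 1 and has the
    difference 1 twice, so there the offsets may disagree by 1.\<close>
  have KZ: "\<forall>e\<in>E. \<forall>f\<in>E. \<forall>e'\<in>E'. \<forall>f'\<in>E'.
      (\<bar>(e - f) - (e' - f')\<bar> \<le> 16 \<or> \<bar>(e - f) - (e' - f')\<bar> = 18) \<and>
      (e - f = e' - f' \<and> e \<noteq> f \<longrightarrow> e = e' \<or> (s = 0 \<and> s' = 1 \<or> s = 1 \<and> s' = 0) \<and> \<bar>e - e'\<bar> = 1)"
    if m: "E \<in> FZ s" "E' \<in> FZ s'" "s \<noteq> s'" for E E' s s'
  proof -
    consider "E = {0, 2, 9}" "E' \<in> {{0, 2, 9}, {0, 1, 2}, {3, 6, 9}}"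
      | "E \<in> {{0, 1, 2}, {3, 6, 9}}" "E' = {0, 2, 9}"
      | "E = {0, 1, 2}" "E' \<in> {{0, 1, 2}, {3, 6, 9}}" "s = 0 \<and> s' = 1 \<or> s = 1 \<and> s' = 0"
      | "E = {3, 6, 9}" "E' = {0, 1, 2}"
      using m unfolding FZ_def by (auto split: if_splits)
    then show ?thesis
    proof cases
      case 1 then show ?thesis by (elim insertE emptyE) simp_all
    next
      case 2 then show ?thesis by (elim insertE emptyE) simp_all
    next
      case 3 then show ?thesis by (elim insertE emptyE) simp_all
    qed simp
  qed
  have UU': "p = p'" if p: "p \<in> U s ` E" "p \<in> U s' ` E'" "p' \<in> U s ` E" "p' \<in> U s' ` E'" "s \<noteq> s'"
    and s: "s \<in> C" "s' \<in> C" and E: "E \<in> FY s" "E' \<in> FY s'" for p p' s s' E E'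
  proof (rule ccontr)
    assume "p \<noteq> p'"
    obtain e e' f f' where e: "e \<in> E" "e' \<in> E'" "f \<in> E" "f' \<in> E'" "p = U s e" "p' = U s f"
      "U s e = U s' e'" "U s f = U s' f'" using p(1-4) unfolding image_iff by metis
    then have d: "q dvd 2 * s + e - (2 * s' + e')" "q dvd 2 * s + f - (2 * s' + f')"
      by (simp_all add: U_def mod_eq_dvd_iff)
    then have "q dvd (2 * s + e - (2 * s' + e')) - (2 * s + f - (2 * s' + f'))" by (rule dvd_diff)
    then have "q dvd (e - f) - (e' - f')" by (simp add: algebra_simps)
    moreover note K = KY[OF E p(5), rule_format, OF e(1,3,2,4)]
    ultimately have "e - f = e' - f'" using small[of "(e - f) - (e' - f')"] by simp
    moreover have "e \<noteq> f" using e \<open>p \<noteq> p'\<close> by auto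
    ultimately have "e = e'" using K by simp
    then show False using d(1) eqs s p(5) by (simp add: right_diff_distrib)
  qed
  have WW': "p = p'" if p: "p \<in> W s ` E" "p \<in> W s' ` E'" "p' \<in> W s ` E" "p' \<in> W s' ` E'" "s \<noteq> s'"
    and s: "s \<in> C" "s' \<in> C" and E: "E \<in> FZ s" "E' \<in> FZ s'" for p p' s s' E E'
  proof (rule ccontr)
    assume "p \<noteq> p'"
    obtain e e' f f' where e: "e \<in> E" "e' \<in> E'" "f \<in> E" "f' \<in> E'" "p = W s e" "p' = W s f"
      "W s e = W s' e'" "W s f = W s' f'" using p(1-4) unfolding image_iff by metis
    then have d: "q dvd 2 * s - e - (2 * s' - e')" "q dvd 2 * s - f - (2 * s' - f')"
      by (simp_all add: W_def mod_eq_dvd_iff)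
    have "q dvd (2 * s - f - (2 * s' - f')) - (2 * s - e - (2 * s' - e'))" using d(2,1) by (rule dvd_diff)
    then have "q dvd (e - f) - (e' - f')" by (simp add: algebra_simps)
    moreover note K = KZ[OF E p(5), rule_format, OF e(1,3,2,4)]
    ultimately have "e - f = e' - f'" using small[of "(e - f) - (e' - f')"] by simp
    moreover have "e \<noteq> f" using e \<open>p \<noteq> p'\<close> by auto
    ultimately have "e = e' \<or> (s = 0 \<and> s' = 1 \<or> s = 1 \<and> s' = 0) \<and> \<bar>e - e'\<bar> = 1"
      using K by simp
    then show False
    proof
      assume "e = e'"
      then show False using d(1) eqs s p(5) by (simp add: right_diff_distrib)
    next
      assume "(s = 0 \<and> s' = 1 \<or> s = 1 \<and> s' = 0) \<and> \<bar>e - e'\<bar> = 1"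
      \<comment> \<open>Between classes 0 and 1 the term \<open>2 * (s - s')\<close> is 2 or -2,
        which an offset difference of 1 or -1 cannot cancel.\<close>
      then have "\<bar>2 * s - e - (2 * s' - e')\<bar> \<le> 16" "2 * s - e - (2 * s' - e') \<noteq> 0" by arith+
      then show False using d(1) small by blast
    qed
  qed
  have dist: "card (h ` E) = 3" if "inj_on h E" "card E = 3" for h :: "int \<Rightarrow> nat \<times> int" and E
    using that by (simp add: card_image)
  have "rainbow_classes (nat q - 2) V C P R"
  proof (rule rainbow_classesI)
    show "finite V" by (simp add: V_def)
    have "{0, 1, 2, 9} \<subseteq> {0..<q}" using assms(2) by auto
    then have cA: "card ({0..<q} - {0, 1, 2, 9}) = nat q - 4" by (simp add: card_Diff_subset numeral_eq_Suc)
    have "card V \<le> card ({0 :: nat} \<times> ({0..<q} - {0, 1, 2, 9})) + card ({1 :: nat, 2} \<times> {0..<q})"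
      unfolding V_def by (rule card_Un_le)
    also have "\<dots> = nat q - 4 + 2 * nat q" using cA by (simp add: card_cartesian_product)
    finally show "card V \<le> 3 * (nat q - 2) + 2" using assms(2) by linarith
    show "finite C" by (simp add: C_def)
    show "nat q - 2 \<le> card C" unfolding C_def using assms(2) by (subst card_Diff_subset) auto
  next
    fix s assume s: "s \<in> C"
    show "finite (P s)" by (simp add: P_def A_def FY_def FZ_def)
    show "R s \<in> P s" using s by (auto simp: R_def P_def A_def FY_def FZ_def C_def)
    have iU: "inj_on (image (U s)) (FY s)"
    proof (rule inj_onI)
      fix E E' assume E: "E \<in> FY s" "E' \<in> FY s" "U s ` E = U s ` E'"
      then obtain e where "e \<in> E" by (auto simp: FY_def split: if_splits)
      then show "E = E'" using UU[of "U s e" s E E'] E by blast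
    qed
    have iW: "inj_on (image (W s)) (FZ s)"
    proof (rule inj_onI)
      fix E E' assume E: "E \<in> FZ s" "E' \<in> FZ s" "W s ` E = W s ` E'"
      then obtain e where "e \<in> E" by (auto simp: FZ_def split: if_splits)
      then show "E = E'" using WW[of "W s e" s E E'] E by blast
    qed
    have cU: "card (image (U s) ` FY s) = (if s = 0 then 2 else 1)"
      using card_image[OF iU] by (simp add: FY_def card_insert_if set_eq_subset split: if_splits)
    have cW: "card (image (W s) ` FZ s) = (if s = 0 then 2 else 1)"
      using card_image[OF iW] by (simp add: FZ_def card_insert_if set_eq_subset split: if_splits)
    have "inj_on (T s) (A s)"
      using TT by (intro inj_onI) (metis TUW insertI1)
    then have cT: "card (T s ` A s) = card (A s)" by (rule card_image)
    have cA: "card (A s) = nat q - (if s = 0 then 6 else 4)"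
    proof -
      have "A s = {0..<q} - (if s = 0 then {0, 1, 2, 9, 3, 6} else {0, 1, 2, 9})" by (auto simp: A_def)
      then show ?thesis using assms(2) by (simp add: card_Diff_subset numeral_eq_Suc)
    qed
    have "T s x \<noteq> U s ` E" "T s x \<noteq> W s ` E" for x E
      using ne by (metis TUW imageE insertI1)+
    then have d1: "T s ` A s \<inter> image (U s) ` FY s = {}" "T s ` A s \<inter> image (W s) ` FZ s = {}" by blast+
    have "U s ` E \<noteq> W s ` E'" if "E \<in> FY s" for E E'
      using that ne by (auto simp: FY_def set_eq_subset split: if_splits)
    then have d2: "image (U s) ` FY s \<inter> image (W s) ` FZ s = {}" by blast
    have fin: "finite (T s ` A s)" "finite (image (U s) ` FY s)" "finite (image (W s) ` FZ s)"
      by (simp_all add: A_def FY_def FZ_def)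
    have "card (P s) = card (T s ` A s) + card (image (U s) ` FY s) + card (image (W s) ` FZ s)"
      unfolding P_def using card_Un_disjoint[OF fin(1,2) d1(1)] d1(2) d2 fin
      by (subst card_Un_disjoint) (simp_all add: Int_Un_distrib2)
    then show "nat q - 2 \<le> card (P s)" using cT cU cW cA assms(2) by (cases "s = 0"; simp; linarith)
  next
    fix s b assume s: "s \<in> C" "b \<in> P s"
    have "T s x \<subseteq> V" "card (T s x) = 3" if "x \<in> A s" for x
      using that assms(2) by (auto simp: T_def V_def A_def)
    moreover have "U s ` E \<subseteq> V" "card (U s ` E) = 3" if "E \<in> FY s" for E
    proof -
      show "U s ` E \<subseteq> V" using assms(2) by (auto simp: U_def V_def)
      have "card E = 3" using that by (auto simp: FY_def split: if_splits)
      then show "card (U s ` E) = 3" using Uinj FY0 that by (intro dist inj_onI) auto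
    qed
    moreover have "W s ` E \<subseteq> V" "card (W s ` E) = 3" if "E \<in> FZ s" for E
    proof -
      show "W s ` E \<subseteq> V" using assms(2) by (auto simp: W_def V_def)
      have "card E = 3" using that by (auto simp: FZ_def split: if_splits)
      then show "card (W s ` E) = 3" using Winj FZ0 that by (intro dist inj_onI) auto
    qed
    ultimately show "b \<subseteq> V" "card b = 3" using s(2) unfolding P_def by blast+
  next
    have TU: "p \<notin> U s ` E" if "p \<in> T s x" "x \<in> A s" "E \<in> FY s" for p s x E
    proof
      assume "p \<in> U s ` E"
      then obtain e where e: "e \<in> E" "p = U s e" by blast
      then have "U s x = U s e" using that(1) ne by (auto simp: TUW)
      then have "x = e" using Uinj AD[OF that(2)] FY0[OF e(1) that(3)] by metis
      then show False using AY[OF that(2) e(1) that(3)] by simp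
    qed
    have TW: "p \<notin> W s ` E" if "p \<in> T s x" "x \<in> A s" "E \<in> FZ s" for p s x E
    proof
      assume "p \<in> W s ` E"
      then obtain e where e: "e \<in> E" "p = W s e" by blast
      then have "W s x = W s e" using that(1) ne by (auto simp: TUW)
      then have "x = e" using Winj AD[OF that(2)] FZ0[OF e(1) that(3)] by metis
      then show False using AZ[OF that(2) e(1) that(3)] by simp
    qed
    have UW: "p \<notin> W s ` E'" if "p \<in> U s ` E" for p s E E' using that by auto
    fix s b b' p assume b: "s \<in> C" "b \<in> P s" "b' \<in> P s" "p \<in> b" "p \<in> b'"
    from b(2,3) show "b = b'" unfolding P_def
      by (elim UnE imageE) (use b(4,5) TT TU TW UU WW UW in metis)+
  next
    fix s s' b b' p p'
    assume s: "s \<in> C" "s' \<in> C" "b \<in> P s" "b' \<in> P s'" "s \<noteq> s'"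
      and p: "p \<in> b" "p \<in> b'" "p' \<in> b" "p' \<in> b'"
    have TU: "p = p'" if "p \<in> T s x" "p' \<in> T s x" "p \<in> U s' ` E" "p' \<in> U s' ` E" for p p' s s' x E
      using that by (auto simp: TUW)
    have TW: "p = p'" if "p \<in> T s x" "p' \<in> T s x" "p \<in> W s' ` E" "p' \<in> W s' ` E" for p p' s s' x E
      using that by (auto simp: TUW)
    have UW: "p \<notin> W s' ` E'" if "p \<in> U s ` E" for p s s' E E' using that by auto
    from s(3,4) show "p = p'" unfolding P_def
      by (elim UnE imageE) (use p s(1,2,5) TT' TU TW UU' WW' UW in metis)+
  next
    fix s s' p assume s: "s \<in> C" "s' \<in> C" and p: "p \<in> R s" "p \<in> R s'"
    have T0: False if "s \<noteq> 0" "s \<noteq> 1" "s \<in> C" "p \<in> T s s" "p \<in> U 0 ` {0, 3, 6}" for s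
    proof -
      \<comment> \<open>The second coordinate at \<open>x = s\<close> is \<open>3 * s\<close>, so a
        common point forces \<open>s\<close> to be 0, 1 or 2, and class 2 was dropped.\<close>
      have "\<exists>c\<in>{0, 1, 2}. U s s = U 0 (3 * c)" using that(4,5) by (auto simp: TUW)
      then obtain c where c: "c \<in> {0, 1, 2}" and "U s s = U 0 (3 * c)" by blast
      then have "q dvd (2 * s + s) - (2 * 0 + 3 * c)" unfolding U_def prod.inject mod_eq_dvd_iff by blast
      then have "q dvd s - c" using odd3[of "s - c"] by (simp add: algebra_simps)
      moreover have "c \<in> {0..<q}" using c assms(2) by auto
      ultimately have "s = c" using eq_if_dvd_diff CD[OF that(3)] by metis
      then show False using that(1-3) c by (auto simp: C_def)
    qed
    have T1: False if "s \<noteq> 0" "s \<noteq> 1" "s \<in> C" "p \<in> T s s" "p \<in> W 1 ` {0, 1, 2}" for s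
    proof -
      \<comment> \<open>The third coordinate at \<open>x = s\<close> is \<open>s\<close> itself, and
        \<open>W 1 (2 - c)\<close> is the residue \<open>c\<close>.\<close>
      have "\<exists>c\<in>{0, 1, 2}. W s s = W 1 (2 - c)" using that(4,5) by (auto simp: TUW)
      then obtain c where c: "c \<in> {0, 1, 2}" and "W s s = W 1 (2 - c)" by blast
      then have "q dvd (2 * s - s) - (2 * 1 - (2 - c))" unfolding W_def prod.inject mod_eq_dvd_iff by blast
      then have "q dvd s - c" by simp
      moreover have "c \<in> {0..<q}" using c assms(2) by auto
      ultimately have "s = c" using eq_if_dvd_diff CD[OF that(3)] by metis
      then show False using that(1-3) c by (auto simp: C_def)
    qed
    have T2: "s = s'" if "p \<in> T s s" "p \<in> T s' s'"
    proof -
      have "q dvd 3 * (s - s') \<or> q dvd s - s'"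
        using that by (auto simp: T_def mod_eq_dvd_iff)
      then show ?thesis using odd3 eq_if_dvd_diff CD s by blast
    qed
    have UW: "p \<notin> W 1 ` {0, 1, 2}" if "p \<in> U 0 ` {0, 3, 6}" using that by auto
    show "s = s'" using p s T0[of s] T0[of s'] T1[of s] T1[of s'] T2 UW
      unfolding R_def by (simp split: if_splits)
  qed
  then show ?thesis by blast
qed

section \<open>Choice of the construction by the residue of \<open>n - 1\<close> mod 6\<close>

theorem theorem2p8:
  fixes n \<rho> :: nat
  assumes "n \<ge> 4" and "n \<noteq> 6" and "1 \<le> \<rho>" and "\<rho> \<le> n - 1"
  shows "\<exists>(X :: nat set) B. card X = 3 * n - 1 + \<rho> \<and> is_packing 4 X B \<and>
           card B = (n - 1) * \<rho> + D \<rho> 4 \<and> largest_ppc_size B \<rho>"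
proof -
  define m where "m = n - 1"
  have m: "3 \<le> m" "1 \<le> m" "\<rho> \<le> m" and nm: "3 * n - 1 = 3 * m + 2"
    using assms by (auto simp: m_def)
  note packing = packing_of_rainbow_classes[OF _ m(3,2)]
  have coprime6: "coprime q 6" if "q mod 6 = 1 \<or> q mod 6 = 5" for q :: nat
    using that by (auto simp: coprime_iff_gcd_eq_1 gcd_red_nat[of q] gcd_red_nat[of 6 5])
  \<comment> \<open>In the residue classes 2 and 3 the repaired constructions start at
    \<open>q = 13\<close> and \<open>q = 17\<close>, that is at \<open>m = 14\<close> and
    \<open>m = 15\<close>; the smaller values 3, 8, 9 are left to the fields.\<close>
  have "m = 3 \<or> m = 8 \<or> m = 9 \<or> m mod 6 = 1 \<or> m mod 6 = 5 \<or> m mod 6 = 0 \<or> m mod 6 = 4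
      \<or> m mod 6 = 2 \<and> 14 \<le> m \<or> m mod 6 = 3 \<and> 15 \<le> m"
    using m(1) by presburger
  then consider "m = 3" | "m = 8" | "m = 9" | "m mod 6 = 1 \<or> m mod 6 = 5" | "m mod 6 = 0 \<or> m mod 6 = 4"
    | "m mod 6 = 2" "14 \<le> m" | "m mod 6 = 3" "15 \<le> m"
    by argo
  then have "\<exists>(X :: nat set) B. card X = 3 * m + 2 + \<rho> \<and> is_packing 4 X B \<and>
           card B = m * \<rho> + D \<rho> 4 \<and> largest_ppc_size B \<rho>"
  proof cases
    case 1 then show ?thesis using rainbow_classes_3 by (intro packing) simp
  next
    case 2
    define X where "X = {0..<3 :: int} \<times> {0..<3 :: int} - {(0, 0)}"
    have "card X = 8" "X \<subseteq> {0..<3} \<times> {0..<3}"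
      unfolding X_def by (auto simp: card_Diff_singleton card_cartesian_product)
    then show ?thesis using 2 rainbow_classes_field_9[of X] by (intro packing) simp
  next
    case 3
    define X where "X = {0..<3 :: int} \<times> {0..<3 :: int}"
    have "card X = 9" "X \<subseteq> {0..<3} \<times> {0..<3}"
      unfolding X_def by (auto simp: card_cartesian_product)
    then show ?thesis using 3 rainbow_classes_field_9[of X] by (intro packing) simp
  next
    case 4
    then show ?thesis
      using rainbow_classes_cyclic[of m "{0..<int m}"] coprime6[of m] by (intro packing) simp
  next
    case 5
    \<comment> \<open>Here \<open>q = m + 1\<close>, and the residue 0 is deleted from the first
      copy.\<close>
    then have "(m + 1) mod 6 = 1 \<or> (m + 1) mod 6 = 5" by presburger
    then show ?thesis
      using rainbow_classes_cyclic[of "m + 1" "{1..<int (m + 1)}"] coprime6[of "m + 1"]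
      by (intro packing) simp
  next
    case 6
    then have "(int m - 1) mod 6 = 1" "int m - 1 \<ge> 13" by presburger+
    moreover have "nat (int m - 1) + 1 = m" using m(1) by linarith
    ultimately show ?thesis
      using rainbow_classes_add_points[of "int m - 1"] by (intro packing) simp
  next
    case 7
    then have "(int m + 2) mod 6 = 5" "int m + 2 \<ge> 17" by presburger+
    moreover have "nat (int m + 2) - 2 = m" by linarith
    ultimately show ?thesis
      using rainbow_classes_delete_points[of "int m + 2"] by (intro packing) simp
  qed
  then show ?thesis unfolding nm m_def[symmetric] .
qed

end
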